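(* Let $X$, $Y$, $Z$ be locally convex Hausdorff topological vector spaces, and let $F\colon X \rightrightarrows Y$ be a multifunction whose graph is given by $$\mathrm{gph}\,F=\big\{(x,y)\in X\times Y \;\big|\; A_1(x)+A_2(y)=z,\ \langle x_i^*,x\rangle+\langle y_i^*,y\rangle\le \beta_i,\ i=1,\dots,m\big\},$$ where $A_1\colon X\to Z$ and $A_2\colon Y\to Z$ are continuous linear mappings, $z\in Z$, and $x_i^*\in X^*$, $y_i^*\in Y^*$, $\beta_i\in\mathbb{R}$ for $i=1,\dots,m$. If the mapping $A_1$ is closed under finite-codimensional subspaces, then $\mathrm{rge}\,F$ is a generalized polyhedral convex set in $Y$.
   Context: All vector spaces are real. $X^*$ denotes the topological dual of $X$ and $\langle x^*,x\rangle$ the value of $x^*\in X^*$ at $x\in X$. A multifunction $F\colon X\rightrightarrows Y$ assigns to each $x\in X$ a (possibly empty) subset $F(x)\subset Y$; $\mathrm{rge}\,F=\{y\in Y\mid \exists x\in X:\ y\in F(x)\}$ and $\mathrm{gph}\,F=\{(x,y)\in X\times Y\mid y\in F(x)\}$. A subset $D$ of a locally convex Hausdorff topological vector space $X$ is a generalized polyhedral convex set if there exist finitely many $x_i^*\in X^*$, $\alpha_i\in\mathbb{R}$, $i=1,\dots,m$, and a closed affine subspace $L\subset X$ such that $D=\{x\in X\mid x\in L,\ \langle x_i^*,x\rangle\le\alpha_i,\ i=1,\dots,m\}$. The empty set counts as generalized polyhedral convex. A continuous linear mapping $A\colon X\to Z$ is closed under finite-codimensional subspaces if $A(X_0)$ is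 closed in $Z$ for every closed linear subspace $X_0\subset X$ of finite codimension (i.e. $\dim(X/X_0)<\infty$). *)

theory Defs
  imports "HOL-Analysis.Analysis"
begin

class topological_real_vector = real_vector + topological_ab_group_add +
  assumes tendsto_scaleR_Pair: "LIM x (nhds a \<times>\<^sub>F nhds b). fst x *\<^sub>R snd x :> nhds (a *\<^sub>R b)"

text \<open>
  By translation invariance it is enough to ask for small convex neighbourhoods of the origin. The
  convexity of \<open>C\<close> is spelled out because \<^const>\<open>convex\<close> cannot occur in a class specification.
\<close>

class locally_convex_hausdorff_space = topological_real_vector + t2_space +
  assumes locally_convex_zero:
    "open U \<Longrightarrow> 0 \<in> U \<Longrightarrow> \<exists>V C. open V \<and> 0 \<in> V \<and> V \<subseteq> C \<and> C \<subseteq> U \<and>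
      (\<forall>x\<in>C. \<forall>y\<in>C. \<forall>u\<ge>0. \<forall>v\<ge>0. u + v = 1 \<longrightarrow> u *\<^sub>R x + v *\<^sub>R y \<in> C)"

instance real_normed_vector \<subseteq> locally_convex_hausdorff_space
proof
  fix a :: real and b :: 'a
  show "LIM x (nhds a \<times>\<^sub>F nhds b). fst x *\<^sub>R snd x :> nhds (a *\<^sub>R b)"
    using tendsto_scaleR[OF tendsto_fst[OF filterlim_ident, of "(a,b)"]
        tendsto_snd[OF filterlim_ident, of "(a,b)"]]
    by (simp add: nhds_prod)
next
  fix U :: "'a set"
  assume "open U" and "0 \<in> U"
  then obtain e where "e > 0" and "ball 0 e \<subseteq> U"
    using openE by blast
  then have "open (ball 0 e) \<and> 0 \<in> ball 0 e \<and> ball 0 e \<subseteq> ball 0 e \<and> ball 0 e \<subseteq> U \<and> convex (ball (0::'a) e)"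
    by simp
  then show "\<exists>V C. open V \<and> 0 \<in> V \<and> V \<subseteq> C \<and> C \<subseteq> U \<and>
      (\<forall>x\<in>C. \<forall>y\<in>C. \<forall>u\<ge>0. \<forall>v\<ge>0. u + v = 1 \<longrightarrow> u *\<^sub>R x + v *\<^sub>R y \<in> C)"
    unfolding convex_def by blast
qed

definition continuous_linear ::
    "('a::topological_real_vector \<Rightarrow> 'b::topological_real_vector) \<Rightarrow> bool" where
  "continuous_linear A \<longleftrightarrow> linear A \<and> continuous_on UNIV A"

definition topological_dual :: "('a::topological_real_vector \<Rightarrow> real) set" where
  "topological_dual = {f. continuous_linear f}"

text \<open>A multifunction from \<open>'a\<close> to \<open>'b\<close> is a map \<open>'a \<Rightarrow> 'b set\<close>; the value may be empty.\<close>

definition gph :: "('a \<Rightarrow> 'b set) \<Rightarrow> ('a \<times> 'b) set" where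
  "gph F = {(x, y). y \<in> F x}"

definition rge :: "('a \<Rightarrow> 'b set) \<Rightarrow> 'b set" where
  "rge F = {y. \<exists>x. y \<in> F x}"

text \<open>
  \<^const>\<open>affine\<close> admits the empty set. This does not enlarge the class of sets below, since the
  empty set is also given by the whole space and the single inequality \<open>0 \<le> - 1\<close>.
\<close>

definition generalized_polyhedral_convex :: "'a::locally_convex_hausdorff_space set \<Rightarrow> bool" where
  "generalized_polyhedral_convex D \<longleftrightarrow>
    (\<exists>(m::nat) xs \<alpha> L.
      (\<forall>i\<in>{1..m}. xs i \<in> topological_dual) \<and> affine L \<and> closed L \<and>
      D = {x. x \<in> L \<and> (\<forall>i\<in>{1..m}. xs i x \<le> \<alpha> i)})"

definition coset_of :: "'a::real_vector set \<Rightarrow> 'a \<Rightarrow> 'a set" where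
  "coset_of X0 x = {x + u | u. u \<in> X0}"

text \<open>
  The quotient by \<open>X0\<close> is finite-dimensional: finitely many classes \<open>coset_of X0 b\<close> span it. A linear
  combination of classes is the class of the linear combination of their representatives.
\<close>

definition finite_codimensional :: "'a::real_vector set \<Rightarrow> bool" where
  "finite_codimensional X0 \<longleftrightarrow>
    subspace X0 \<and>
    (\<exists>B. finite B \<and> (\<forall>x. \<exists>c. coset_of X0 x = coset_of X0 (\<Sum>b\<in>B. c b *\<^sub>R b)))"

definition closed_under_finite_codimensional_subspaces ::
    "('a::topological_real_vector \<Rightarrow> 'b::topological_real_vector) \<Rightarrow> bool" where
  "closed_under_finite_codimensional_subspaces A \<longleftrightarrow>
    (\<forall>X0. subspace X0 \<and> closed X0 \<and> finite_codimensional X0 \<longrightarrow> closed (A ` X0))"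

end

theory Submission
  imports Defs
begin

text \<open>
  Fix \<open>y\<close>. It lies in the range iff \<open>z - A2 y\<close> is of the form \<open>A1 x0\<close> and, for some \<open>k\<close> in the kernel
  \<open>K\<close> of \<open>A1\<close>, all inequalities \<open>xs i k \<le> \<beta> i - ys i y - xs i x0\<close> hold. Which right-hand sides \<open>u\<close>
  admit such a \<open>k\<close> is decided by finitely many inequalities \<open>0 \<le> (\<Sum>i. c i * u i)\<close>; this is
  Fourier-Motzkin elimination (\<open>feasible_rhs_polyhedral\<close>) and uses no topology. Since feasibility at
  \<open>u\<close> for \<open>u = (xs i k)\<^sub>i\<close> and for \<open>u = (- xs i k)\<^sub>i\<close> is evident, the functional
  \<open>g = (\<Sum>i. c i * xs i)\<close> vanishes on \<open>K\<close> for each of these \<open>c\<close>, so the resulting inequality involves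
  \<open>x0\<close> only through the number \<open>g x0\<close>, which is determined by \<open>A1 x0 = z - A2 y\<close>.

  It remains to see that \<open>g x0\<close> depends on \<open>A1 x0\<close> through a continuous functional on the whole
  target space (\<open>factor_through_continuous_functional\<close>). The induced functional on \<open>range A1\<close> has
  the kernel \<open>A1 ` ker g\<close>. As \<open>ker g\<close> is closed with codimension at most one, this image is
  closed by hypothesis, and the Hahn-Banach theorem separates it from a point of \<open>range A1\<close>.
  Finally \<open>range A1\<close> is closed, as the image of the whole space, so the equation
  \<open>z - A2 y \<in> range A1\<close> describes a closed affine subspace.

  The Hahn-Banach theorem is obtained by minimality: Zorn's lemma gives a minimal sublinear
  functional below a given one, and a minimal sublinear functional is linear.
\<close>

section \<open>Fourier-Motzkin elimination\<close>

text \<open>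
  A system in one unknown is solvable iff every lower bound for \<open>t\<close> lies below every upper bound; a
  pair of bounds is compared after clearing denominators.
\<close>

lemma one_variable_elimination:
  fixes a d :: "'i \<Rightarrow> real"
  assumes "finite L"
  shows "(\<exists>t. \<forall>l\<in>L. t * d l \<le> a l) \<longleftrightarrow>
    (\<forall>l\<in>L. d l = 0 \<longrightarrow> 0 \<le> a l) \<and>
    (\<forall>l\<in>L. \<forall>p\<in>L. 0 < d l \<longrightarrow> d p < 0 \<longrightarrow> 0 \<le> d l * a p - d p * a l)"
    (is "?solvable \<longleftrightarrow> ?zero \<and> ?pairs")
proof (intro iffI conjI)
  assume ?solvable
  then obtain t where t: "\<And>l. l \<in> L \<Longrightarrow> t * d l \<le> a l" by blast
  show ?zero using t by fastforce
  show ?pairs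
  proof (intro ballI impI)
    fix l p assume "l \<in> L" "p \<in> L" and d: "0 < d l" "d p < 0"
    have "d l * (t * d p) \<le> d l * a p"
      using t[OF \<open>p \<in> L\<close>] d by (simp add: mult_left_mono)
    moreover have "d p * a l \<le> d p * (t * d l)"
      using t[OF \<open>l \<in> L\<close>] d by (simp add: mult_left_mono_neg)
    ultimately show "0 \<le> d l * a p - d p * a l" by (simp add: algebra_simps)
  qed
next
  assume zp: "?zero \<and> ?pairs"
  define lower upper where "lower = (\<lambda>p. a p / d p) ` {p\<in>L. d p < 0}"
    and "upper = (\<lambda>l. a l / d l) ` {l\<in>L. 0 < d l}"
  have fin: "finite lower" "finite upper"
    using assms by (simp_all add: lower_def upper_def)
  have le: "r \<le> s" if rs: "r \<in> lower" "s \<in> upper" for r s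
  proof -
    obtain p l where pl: "p \<in> L" "d p < 0" "r = a p / d p" "l \<in> L" "0 < d l" "s = a l / d l"
      using rs by (auto simp: lower_def upper_def)
    then have "0 \<le> d l * a p - d p * a l" using zp by blast
    then show ?thesis using pl by (simp add: neg_divide_le_eq pos_divide_le_eq mult.commute)
  qed
  obtain t where t: "\<And>r. r \<in> lower \<Longrightarrow> r \<le> t" "\<And>s. s \<in> upper \<Longrightarrow> t \<le> s"
  proof (cases "lower = {}")
    case True
    show ?thesis
    proof (rule that)
      show "r \<le> (if upper = {} then 0 else Min upper)" if "r \<in> lower" for r
        using that True by simp
      show "(if upper = {} then 0 else Min upper) \<le> s" if "s \<in> upper" for s
        using that fin by auto
    qed
  next
    case False
    show ?thesis
      by (rule that[of "Max lower"]) (use False fin le in auto)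
  qed
  have "t * d l \<le> a l" if "l \<in> L" for l
  proof (cases "d l" "0::real" rule: linorder_cases)
    case less
    then have "a l / d l \<le> t" using t(1) that by (auto simp: lower_def)
    then show ?thesis using less by (simp add: field_simps)
  next
    case equal
    then show ?thesis using zp that by simp
  next
    case greater
    then have "t \<le> a l / d l" using t(2) that by (auto simp: upper_def)
    then show ?thesis using greater by (simp add: field_simps)
  qed
  then show ?solvable by blast
qed

text \<open>
  The induction runs over the functionals and not over a basis, because \<open>K\<close> may be
  infinite-dimensional. A new functional \<open>f j\<close> that does not vanish on \<open>K\<close> splits \<open>K\<close> into its kernel,
  to which the induction hypothesis applies, and one line, whose coordinate \<open>t\<close> is eliminated.
\<close>

lemma feasible_rhs_polyhedral:
  fixes f :: "'i \<Rightarrow> 'a::real_vector \<Rightarrow> real"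
  assumes "finite I" "\<And>i. i \<in> I \<Longrightarrow> linear (f i)" "subspace K"
  shows "\<exists>\<Lambda>. finite \<Lambda> \<and>
    (\<forall>u. (\<exists>k\<in>K. \<forall>i\<in>I. f i k \<le> u i) \<longleftrightarrow> (\<forall>c\<in>\<Lambda>. 0 \<le> (\<Sum>i\<in>I. c i * u i)))"
  using assms
proof (induction I arbitrary: K rule: finite_induct)
  case empty
  then show ?case using subspace_0 by (intro exI[of _ "{}"]) auto
next
  case (insert j I)
  have lin: "linear (f i)" if "i \<in> insert j I" for i using insert.prems that by blast
  define K0 where "K0 = {k\<in>K. f j k = 0}"
  have "subspace K0"
    using insert.prems(2) lin[of j]
    by (auto simp: K0_def subspace_def linear_add linear_scale linear_0)
  obtain \<Lambda> where \<Lambda>: "finite \<Lambda>"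
    and feas: "\<And>u. (\<exists>k\<in>K0. \<forall>i\<in>I. f i k \<le> u i) \<longleftrightarrow> (\<forall>c\<in>\<Lambda>. 0 \<le> (\<Sum>i\<in>I. c i * u i))"
    using insert.IH[OF lin[OF insertI2] \<open>subspace K0\<close>] by blast
  \<comment> \<open>The inequalities for \<open>K0\<close>, made independent of \<open>u j\<close>, together with the inequality \<open>0 \<le> u j\<close>.\<close>
  define \<Lambda>' where "\<Lambda>' = insert (\<lambda>i. if i = j then 1 else 0) ((\<lambda>c. c(j := 0)) ` \<Lambda>)"
  have fin': "finite \<Lambda>'" using \<Lambda> by (simp add: \<Lambda>'_def)
  have "(\<Sum>i\<in>insert j I. (if i = j then 1 else 0) * v i) = v j" for v :: "'i \<Rightarrow> real"
  proof -
    have "(\<Sum>i\<in>insert j I. (if i = j then 1 else 0) * v i) = (\<Sum>i\<in>insert j I. if i = j then v i else 0)"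
      by (intro sum.cong) auto
    then show ?thesis using insert.hyps by (subst (asm) sum.delta) auto
  qed
  moreover have "(\<Sum>i\<in>insert j I. (c(j := 0)) i * v i) = (\<Sum>i\<in>I. c i * v i)" for c v :: "'i \<Rightarrow> real"
    using insert.hyps by (auto intro!: sum.cong)
  ultimately have feas0: "0 \<le> v j \<and> (\<exists>k\<in>K0. \<forall>i\<in>I. f i k \<le> v i) \<longleftrightarrow>
      (\<forall>c\<in>\<Lambda>'. 0 \<le> (\<Sum>i\<in>insert j I. c i * v i))" for v
    by (simp add: \<Lambda>'_def feas del: fun_upd_apply sum.insert)
  show ?case
  proof (cases "\<forall>k\<in>K. f j k = 0")
    case True
    then have "K0 = K" by (auto simp: K0_def)
    have "(\<exists>k\<in>K. \<forall>i\<in>insert j I. f i k \<le> u i) \<longleftrightarrow> 0 \<le> u j \<and> (\<exists>k\<in>K0. \<forall>i\<in>I. f i k \<le> u i)" for u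
      using True by (auto simp: \<open>K0 = K\<close>)
    then show ?thesis using fin' feas0 by (intro exI[of _ \<Lambda>']) simp
  next
    case False
    then obtain b0 where b0: "b0 \<in> K" "f j b0 \<noteq> 0" by blast
    define b where "b = b0 /\<^sub>R f j b0"
    have b: "b \<in> K" "f j b = 1"
      using b0 insert.prems(2) lin[of j] by (auto simp: b_def subspace_scale linear_scale)
    define d where "d c = (\<Sum>i\<in>insert j I. c i * f i b)" for c :: "'i \<Rightarrow> real"
    \<comment> \<open>As an inequality for \<open>t\<close>, the member \<open>c\<close> of \<open>\<Lambda>'\<close> has the coefficient \<open>d c\<close>; each pair of a lower
        and an upper bound is combined so that the coefficient of \<open>t\<close> cancels.\<close>
    define \<Lambda>'' where "\<Lambda>'' = {c\<in>\<Lambda>'. d c = 0} \<union>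
      (\<lambda>(c, c') i. d c * c' i - d c' * c i) ` ({c\<in>\<Lambda>'. 0 < d c} \<times> {c\<in>\<Lambda>'. d c < 0})"
    have fin'': "finite \<Lambda>''" using fin' by (simp add: \<Lambda>''_def)
    have split: "(\<exists>k\<in>K. \<forall>i\<in>insert j I. f i k \<le> u i) \<longleftrightarrow>
        (\<exists>t. 0 \<le> u j - t * f j b \<and> (\<exists>k\<in>K0. \<forall>i\<in>I. f i k \<le> u i - t * f i b))" (is "?l \<longleftrightarrow> ?r") for u
    proof
      assume ?l
      then obtain k where k: "k \<in> K" "\<And>i. i \<in> insert j I \<Longrightarrow> f i k \<le> u i" by blast
      let ?k = "k - f j k *\<^sub>R b"
      have "?k \<in> K0"
        using k b insert.prems(2) lin[of j]
        by (auto simp: K0_def linear_diff linear_scale intro: subspace_diff subspace_scale)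
      moreover have "f i ?k \<le> u i - f j k * f i b" if "i \<in> I" for i
        using k(2)[of i] lin[of i] that by (auto simp: linear_diff linear_scale)
      moreover have "0 \<le> u j - f j k * f j b" using k(2)[of j] b by simp
      ultimately show ?r by blast
    next
      assume ?r
      then obtain t k where tk: "0 \<le> u j - t * f j b" "k \<in> K0"
        "\<And>i. i \<in> I \<Longrightarrow> f i k \<le> u i - t * f i b" by blast
      have "k + t *\<^sub>R b \<in> K"
        using tk b insert.prems(2) by (auto simp: K0_def intro: subspace_add subspace_scale)
      moreover have "f i (k + t *\<^sub>R b) \<le> u i" if "i \<in> insert j I" for i
        using tk b lin[of i] that by (auto simp: K0_def linear_add linear_scale algebra_simps)
      ultimately show ?l by blast
    qed
    have "(\<exists>k\<in>K. \<forall>i\<in>insert j I. f i k \<le> u i) \<longleftrightarrow>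
        (\<forall>c\<in>\<Lambda>''. 0 \<le> (\<Sum>i\<in>insert j I. c i * u i))" for u
    proof -
      define a where "a c = (\<Sum>i\<in>insert j I. c i * u i)" for c :: "'i \<Rightarrow> real"
      have "(\<Sum>i\<in>insert j I. c i * (u i - t * f i b)) = a c - t * d c" for c t
        unfolding a_def d_def sum_distrib_left sum_subtractf[symmetric]
        by (intro sum.cong) (auto simp: algebra_simps)
      then have "(\<exists>k\<in>K. \<forall>i\<in>insert j I. f i k \<le> u i) \<longleftrightarrow> (\<exists>t. \<forall>c\<in>\<Lambda>'. t * d c \<le> a c)"
        unfolding split feas0[of "\<lambda>i. u i - t * f i b" for t] by simp
      also have "\<dots> \<longleftrightarrow> (\<forall>c\<in>\<Lambda>'. d c = 0 \<longrightarrow> 0 \<le> a c) \<and>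
          (\<forall>c\<in>\<Lambda>'. \<forall>c'\<in>\<Lambda>'. 0 < d c \<longrightarrow> d c' < 0 \<longrightarrow> 0 \<le> d c * a c' - d c' * a c)"
        by (rule one_variable_elimination[OF fin'])
      also have "\<dots> \<longleftrightarrow> (\<forall>c\<in>\<Lambda>''. 0 \<le> a c)"
      proof -
        have "a (\<lambda>i. s * c' i - r * c i) = s * a c' - r * a c" for s r c c'
          unfolding a_def sum_distrib_left sum_subtractf[symmetric]
          by (intro sum.cong) (auto simp: algebra_simps)
        then show ?thesis by (auto simp: \<Lambda>''_def ball_Un split_paired_Ball_Sigma)
      qed
      finally show ?thesis by (simp add: a_def)
    qed
    then show ?thesis using fin'' by blast
  qed
qed

section \<open>Sublinear functionals and the Hahn-Banach theorem\<close>

definition sublinear :: "('a::real_vector \<Rightarrow> real) \<Rightarrow> bool" where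
  "sublinear p \<longleftrightarrow> (\<forall>x y. p (x + y) \<le> p x + p y) \<and> (\<forall>t\<ge>0. \<forall>x. p (t *\<^sub>R x) = t * p x)"

lemma sublinear_add: "sublinear p \<Longrightarrow> p (x + y) \<le> p x + p y"
  and sublinear_scale: "sublinear p \<Longrightarrow> 0 \<le> t \<Longrightarrow> p (t *\<^sub>R x) = t * p x"
  by (simp_all add: sublinear_def)

lemma sublinear_0: "sublinear p \<Longrightarrow> p 0 = 0"
  using sublinear_scale[of p 0 0] by simp

lemma sublinear_minus_le: "sublinear p \<Longrightarrow> - p (- x) \<le> p x"
  using sublinear_add[of p x "- x"] sublinear_0[of p] by simp

lemma sublinearI:
  assumes add: "\<And>x y. p (x + y) \<le> p x + p y"
    and scale: "\<And>t x. 0 < t \<Longrightarrow> p (t *\<^sub>R x) \<le> t * p x"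
    and zero: "p 0 = 0"
  shows "sublinear p"
proof -
  have "p (t *\<^sub>R x) = t * p x" if "0 \<le> t" for t x
  proof (cases "t = 0")
    case False
    then have "0 < t" using that by simp
    then have "p x \<le> inverse t * p (t *\<^sub>R x)"
      using scale[of "inverse t" "t *\<^sub>R x"] by simp
    then have "t * p x \<le> p (t *\<^sub>R x)" using \<open>0 < t\<close> by (simp add: field_simps)
    then show ?thesis using scale[OF \<open>0 < t\<close>, of x] by simp
  qed (simp add: zero)
  then show ?thesis using add by (simp add: sublinear_def)
qed

text \<open>
  Infima over a family enter three times below; in each of them subadditivity is checked on the
  members of the family.
\<close>

lemma le_cINF_add:
  fixes f g :: "'i \<Rightarrow> real"
  assumes "S \<noteq> {}" "T \<noteq> {}" "\<And>s t. s \<in> S \<Longrightarrow> t \<in> T \<Longrightarrow> c \<le> f s + g t"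
  shows "c \<le> (INF s\<in>S. f s) + (INF t\<in>T. g t)"
proof -
  have "c - f s \<le> (INF t\<in>T. g t)" if "s \<in> S" for s
    using assms that by (intro cINF_greatest) (auto simp: algebra_simps)
  then have "c - (INF t\<in>T. g t) \<le> (INF s\<in>S. f s)"
    using assms by (intro cINF_greatest) (auto simp: algebra_simps)
  then show ?thesis by simp
qed

lemma le_cINF_scale:
  fixes f :: "'i \<Rightarrow> real"
  assumes "S \<noteq> {}" "0 < t" "\<And>s. s \<in> S \<Longrightarrow> c \<le> t * f s"
  shows "c \<le> t * (INF s\<in>S. f s)"
proof -
  have "c / t \<le> (INF s\<in>S. f s)"
    using assms by (intro cINF_greatest) (auto simp: field_simps)
  then show ?thesis using assms(2) by (simp add: field_simps)
qed

text \<open>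
  The value at \<open>- b\<close> can be pushed down to the least value \<open>- p b\<close> that any sublinear functional
  agreeing with \<open>p\<close> at \<open>b\<close> allows. A linear functional below the new \<open>q\<close> therefore attains \<open>p\<close> at \<open>b\<close>,
  and if \<open>p\<close> is minimal, then nothing can be pushed and \<open>p\<close> is odd.
\<close>

lemma sublinear_push_down:
  assumes "sublinear p"
  obtains q where "sublinear q" "\<And>x. q x \<le> p x" "q (- b) \<le> - p b"
proof
  define \<phi> where "\<phi> x t = p (x + t *\<^sub>R b) - t * p b" for x t
  define q where "q x = (INF t\<in>{0..}. \<phi> x t)" for x
  have lower: "- p (- x) \<le> \<phi> x t" if "0 \<le> t" for x t
    using sublinear_add[OF assms, of "x + t *\<^sub>R b" "- x"] sublinear_scale[OF assms that, of b]
    by (simp add: \<phi>_def)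
  have q_le: "q x \<le> \<phi> x t" if "0 \<le> t" for x t
    unfolding q_def using lower that by (intro cINF_lower bdd_belowI2[of _ "- p (- x)"]) auto
  show "q x \<le> p x" for x using q_le[of 0 x] by (simp add: \<phi>_def)
  show "q (- b) \<le> - p b" using q_le[of 1 "- b"] by (simp add: \<phi>_def sublinear_0[OF assms])
  show "sublinear q"
  proof (rule sublinearI)
    fix x y
    show "q (x + y) \<le> q x + q y"
      unfolding q_def[of x] q_def[of y]
    proof (rule le_cINF_add)
      fix s t :: real assume st: "s \<in> {0..}" "t \<in> {0..}"
      have "q (x + y) \<le> \<phi> (x + y) (s + t)" using st by (intro q_le) simp
      also have "\<dots> \<le> \<phi> x s + \<phi> y t"
        using sublinear_add[OF assms, of "x + s *\<^sub>R b" "y + t *\<^sub>R b"]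
        by (simp add: \<phi>_def algebra_simps)
      finally show "q (x + y) \<le> \<phi> x s + \<phi> y t" .
    qed auto
  next
    fix r :: real and x assume r: "0 < r"
    show "q (r *\<^sub>R x) \<le> r * q x"
      unfolding q_def[of x]
    proof (rule le_cINF_scale)
      fix t :: real assume t: "t \<in> {0..}"
      have "q (r *\<^sub>R x) \<le> \<phi> (r *\<^sub>R x) (r * t)" using t r by (intro q_le) simp
      also have "\<dots> = r * \<phi> x t"
        using sublinear_scale[OF assms, of r "x + t *\<^sub>R b"] r
        by (simp add: \<phi>_def algebra_simps)
      finally show "q (r *\<^sub>R x) \<le> r * \<phi> x t" .
    qed (use r in auto)
  next
    have "0 \<le> q 0"
      unfolding q_def using lower[of _ 0] by (intro cINF_greatest) (auto simp: sublinear_0[OF assms])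
    moreover have "q 0 \<le> 0" using q_le[of 0 0] by (simp add: \<phi>_def sublinear_0[OF assms])
    ultimately show "q 0 = 0" by simp
  qed
qed

lemma minimal_sublinear_is_linear:
  assumes p: "sublinear p"
    and minimal: "\<And>q. sublinear q \<Longrightarrow> (\<And>x. q x \<le> p x) \<Longrightarrow> q = p"
  shows "linear p"
proof -
  have minus: "p (- x) = - p x" for x
  proof -
    obtain q where "sublinear q" "\<And>y. q y \<le> p y" "q (- x) \<le> - p x"
      using sublinear_push_down[OF p] by metis
    then have "p (- x) \<le> - p x" using minimal by metis
    then show ?thesis using sublinear_minus_le[OF p, of x] by simp
  qed
  have "p x + p y \<le> p (x + y)" for x y
    using sublinear_add[OF p, of "- x" "- y"] minus[of "x + y"] minus by simp
  then have add: "p (x + y) = p x + p y" for x y using sublinear_add[OF p] by (simp add: antisym)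
  have "p (t *\<^sub>R x) = t * p x" for t x
  proof (cases "0 \<le> t")
    case False
    then show ?thesis
      using sublinear_scale[OF p, of "- t" x] minus[of "t *\<^sub>R x"] by simp
  qed (rule sublinear_scale[OF p])
  then show ?thesis using add by (intro linearI) simp_all
qed

lemma linear_below_sublinear:
  assumes "sublinear p"
  obtains f where "linear f" "\<And>x. f x \<le> p x"
proof -
  define Q where "Q = {q. sublinear q \<and> (\<forall>x. q x \<le> p x)}"
  define P where "P q r \<longleftrightarrow> (\<forall>x. r x \<le> q x)" for q r :: "'a \<Rightarrow> real"
  have "\<exists>m\<in>Q. \<forall>q\<in>Q. P m q \<longrightarrow> q = m"
  proof (rule predicate_Zorn)
    show "partial_order_on Q (relation_of P Q)"
      by (rule partial_order_on_relation_ofI)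
        (auto simp: P_def fun_eq_iff intro: order_trans antisym)
  next
    fix C assume "C \<in> Chains (relation_of P Q)"
    then have CQ: "C \<subseteq> Q" and chain: "\<And>q r. q \<in> C \<Longrightarrow> r \<in> C \<Longrightarrow> P q r \<or> P r q"
      by (auto simp: Chains_def relation_of_def)
    show "\<exists>u\<in>Q. \<forall>q\<in>C. P q u"
    proof (cases "C = {}")
      case True
      then show ?thesis using assms by (auto simp: Q_def)
    next
      case False
      define u where "u x = (INF q\<in>C. q x)" for x
      have sub: "sublinear q" and le_p: "q x \<le> p x" if "q \<in> C" for q x
        using CQ that by (auto simp: Q_def)
      have "- p (- x) \<le> q x" if "q \<in> C" for q x
        using sublinear_minus_le[OF sub[OF that], of x] le_p[OF that, of "- x"] by simp
      then have u_le: "u x \<le> q x" if "q \<in> C" for q x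
        unfolding u_def using that by (intro cINF_lower bdd_belowI2[of _ "- p (- x)"]) auto
      have "sublinear u"
      proof (rule sublinearI)
        fix x y
        show "u (x + y) \<le> u x + u y"
          unfolding u_def[of x] u_def[of y]
        proof (rule le_cINF_add)
          fix q r assume qr: "q \<in> C" "r \<in> C"
          \<comment> \<open>The smaller of \<open>q\<close> and \<open>r\<close> serves for both summands.\<close>
          define s where "s = (if P q r then r else q)"
          have s: "s \<in> C" "\<And>x. s x \<le> q x" "\<And>x. s x \<le> r x"
            using chain[OF qr] qr by (auto simp: s_def P_def)
          have "u (x + y) \<le> s (x + y)" by (rule u_le[OF s(1)])
          also have "\<dots> \<le> s x + s y" by (rule sublinear_add[OF sub[OF s(1)]])
          also have "\<dots> \<le> q x + r y" by (intro add_mono s)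
          finally show "u (x + y) \<le> q x + r y" .
        qed (use False in auto)
      next
        fix t :: real and x assume t: "0 < t"
        show "u (t *\<^sub>R x) \<le> t * u x"
          unfolding u_def[of x]
        proof (rule le_cINF_scale)
          fix q assume q: "q \<in> C"
          show "u (t *\<^sub>R x) \<le> t * q x"
            using u_le[OF q, of "t *\<^sub>R x"] sublinear_scale[OF sub[OF q], of t x] t by simp
        qed (use False t in auto)
      next
        have "u 0 = (INF q\<in>C. 0)" unfolding u_def using sublinear_0[OF sub] by (intro INF_cong) auto
        then show "u 0 = 0" using False by simp
      qed
      moreover have "u x \<le> p x" for x using False u_le le_p by (meson all_not_in_conv order_trans)
      ultimately show ?thesis using u_le by (intro bexI[of _ u]) (auto simp: P_def Q_def)
    qed
  qed
  then obtain m where m: "m \<in> Q" "\<And>q. q \<in> Q \<Longrightarrow> P m q \<Longrightarrow> q = m" by blast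
  have "linear m"
  proof (rule minimal_sublinear_is_linear)
    show "sublinear m" using m(1) by (simp add: Q_def)
    fix q assume "sublinear q" and le: "\<And>x. q x \<le> m x"
    then have "q \<in> Q" using m(1) unfolding Q_def by (auto intro: order_trans)
    then show "q = m" using m(2) le by (simp add: P_def)
  qed
  then show ?thesis using that m(1) by (auto simp: Q_def)
qed

lemma linear_below_sublinear_attaining:
  assumes "sublinear p"
  obtains f where "linear f" "\<And>x. f x \<le> p x" "f b = p b"
proof -
  obtain q where q: "sublinear q" "\<And>x. q x \<le> p x" "q (- b) \<le> - p b"
    using sublinear_push_down[OF assms] by metis
  obtain f where f: "linear f" "\<And>x. f x \<le> q x" using linear_below_sublinear[OF q(1)] by metis
  have below: "f x \<le> p x" for x using f(2) q(2) by (rule order_trans)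
  have "f b = - f (- b)" using f(1) by (simp add: linear_neg)
  then have "p b \<le> f b" using f(2)[of "- b"] q(3) by simp
  then show ?thesis using that f(1) below by (simp add: antisym)
qed

definition gauge_functional :: "'a::real_vector set \<Rightarrow> 'a \<Rightarrow> real" where
  "gauge_functional K x = (INF t\<in>{t. 0 < t \<and> x /\<^sub>R t \<in> K}. t)"

lemma gauge_functional_le: "0 < t \<Longrightarrow> x /\<^sub>R t \<in> K \<Longrightarrow> gauge_functional K x \<le> t"
  unfolding gauge_functional_def by (intro cINF_lower bdd_belowI2[of _ 0]) auto

lemma gauge_functional_nonneg:
  assumes "\<exists>t>0. x /\<^sub>R t \<in> K"
  shows "0 \<le> gauge_functional K x"
  unfolding gauge_functional_def using assms by (intro cINF_greatest) auto

lemma sublinear_gauge_functional: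
  assumes "convex K" "0 \<in> K" and absorbing: "\<And>x. \<exists>t>0. x /\<^sub>R t \<in> K"
  shows "sublinear (gauge_functional K)"
proof (rule sublinearI)
  fix x y
  show "gauge_functional K (x + y) \<le> gauge_functional K x + gauge_functional K y"
    unfolding gauge_functional_def[of K x] gauge_functional_def[of K y]
  proof (rule le_cINF_add)
    fix s t assume st: "s \<in> {s. 0 < s \<and> x /\<^sub>R s \<in> K}" "t \<in> {t. 0 < t \<and> y /\<^sub>R t \<in> K}"
    have "s / (s + t) * inverse s = inverse (s + t)" "t / (s + t) * inverse t = inverse (s + t)"
      using st by (auto simp: field_simps)
    then have "(x + y) /\<^sub>R (s + t) = (s / (s + t)) *\<^sub>R (x /\<^sub>R s) + (t / (s + t)) *\<^sub>R (y /\<^sub>R t)"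
      by (simp only: scaleR_scaleR scaleR_add_right)
    also have "\<dots> \<in> K"
      using st by (intro convexD[OF assms(1)]) (auto simp: add_divide_distrib[symmetric])
    finally show "gauge_functional K (x + y) \<le> s + t" using st by (intro gauge_functional_le) auto
  qed (use absorbing in auto)
next
  fix r :: real and x :: 'a assume r: "0 < r"
  show "gauge_functional K (r *\<^sub>R x) \<le> r * gauge_functional K x"
    unfolding gauge_functional_def[of K x]
  proof (rule le_cINF_scale)
    fix t assume t: "t \<in> {t. 0 < t \<and> x /\<^sub>R t \<in> K}"
    then have "(r *\<^sub>R x) /\<^sub>R (r * t) = x /\<^sub>R t" using r by (simp add: field_simps)
    then show "gauge_functional K (r *\<^sub>R x) \<le> r * t"
      using r t by (intro gauge_functional_le) (simp_all only: mem_Collect_eq mult_pos_pos)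
  qed (use absorbing r in auto)
next
  have "gauge_functional K 0 \<le> t" if "0 < t" for t
    using assms(2) that by (intro gauge_functional_le) auto
  then have "gauge_functional K 0 \<le> 0" by (meson dense not_le)
  moreover have "0 \<le> gauge_functional K 0" by (intro gauge_functional_nonneg absorbing)
  ultimately show "gauge_functional K 0 = 0" by simp
qed

lemma gauge_functional_ge_1:
  assumes "convex K" "0 \<in> K" "\<exists>t>0. x /\<^sub>R t \<in> K" "x \<notin> K"
  shows "1 \<le> gauge_functional K x"
  unfolding gauge_functional_def
proof (rule cINF_greatest)
  fix t assume t: "t \<in> {t. 0 < t \<and> x /\<^sub>R t \<in> K}"
  show "1 \<le> t"
  proof (rule ccontr)
    assume "\<not> 1 \<le> t"
    then have "(1 - t) *\<^sub>R 0 + t *\<^sub>R (x /\<^sub>R t) \<in> K"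
      using t assms by (intro convexD) auto
    then show False using t assms(4) by simp
  qed
qed (use assms(3) in auto)

section \<open>Continuous functionals on locally convex spaces\<close>

lemma tendsto_scaleR_topological:
  fixes g :: "'i \<Rightarrow> 'a::topological_real_vector"
  assumes "(f \<longlongrightarrow> a) F" "(g \<longlongrightarrow> b) F"
  shows "((\<lambda>x. f x *\<^sub>R g x) \<longlongrightarrow> a *\<^sub>R b) F"
proof -
  have "filterlim (\<lambda>x. (f x, g x)) (nhds a \<times>\<^sub>F nhds b) F"
    using assms by (rule filterlim_Pair)
  from filterlim_compose[OF tendsto_scaleR_Pair this] show ?thesis by simp
qed

lemma continuous_linear_if_bounded_above_near_0:
  fixes f :: "'a::topological_real_vector \<Rightarrow> real"
  assumes f: "linear f" and V: "open V" "0 \<in> V" and bound: "\<And>x. x \<in> V \<Longrightarrow> f x \<le> c" and c: "0 < c"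
  shows "continuous_linear f"
proof -
  have "(f \<longlongrightarrow> f a) (at a)" for a
  proof (rule tendstoI)
    fix e :: real assume e: "0 < e"
    have "((\<lambda>x. r *\<^sub>R (x - a)) \<longlongrightarrow> r *\<^sub>R (a - a)) (at a)" for r
      by (intro tendsto_scaleR_topological tendsto_intros)
    then have ev: "\<forall>\<^sub>F x in at a. r *\<^sub>R (x - a) \<in> V" for r
      using V by (auto dest!: topological_tendstoD)
    \<comment> \<open>The bound from above is applied to \<open>x - a\<close> and to its negative. The factor 2 turns the weak bound on \<open>V\<close> into a strict one.\<close>
    show "\<forall>\<^sub>F x in at a. dist (f x) (f a) < e"
      using ev[of "2 * c / e"] ev[of "- (2 * c / e)"]
    proof eventually_elim
      case (elim x)
      have "2 * c * (f x - f a) \<le> c * e" "- (2 * c * (f x - f a)) \<le> c * e"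
        using bound[OF elim(1)] bound[OF elim(2)] e f
        by (simp_all add: linear_scale linear_diff linear_neg field_simps)
      then have "c * (2 * (f x - f a)) \<le> c * e" "c * (- 2 * (f x - f a)) \<le> c * e"
        by (simp_all add: algebra_simps)
      then have "2 * (f x - f a) \<le> e" "- 2 * (f x - f a) \<le> e"
        using c by (simp_all only: mult_le_cancel_left_pos)
      then show ?case using e by (simp add: dist_real_def abs_less_iff)
    qed
  qed
  then show ?thesis using f by (simp add: continuous_linear_def continuous_on_def)
qed

text \<open>
  Take a convex neighbourhood \<open>C\<close> of the origin for which \<open>b - C\<close> misses \<open>W\<close>. The gauge of \<open>C + W\<close> is
  zero on \<open>W\<close>, at least \<open>1\<close> at \<open>b\<close>, and at most \<open>1\<close> on \<open>C\<close>. A linear functional below the gauge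
  that touches it at \<open>b\<close> therefore vanishes on \<open>W\<close>, is continuous, and only has to be rescaled.
\<close>

lemma hahn_banach_separation_from_subspace:
  fixes W :: "'a::locally_convex_hausdorff_space set"
  assumes W: "subspace W" "closed W" and b: "b \<notin> W"
  obtains f where "f \<in> topological_dual" "\<And>w. w \<in> W \<Longrightarrow> f w = 0" "f b = 1"
proof -
  have "open ((\<lambda>x. b - x) -` (- W))"
    using W(2) by (intro open_vimage) (auto intro!: continuous_on_diff continuous_on_const continuous_on_id)
  moreover have "0 \<in> (\<lambda>x. b - x) -` (- W)" using b by simp
  ultimately have "\<exists>V C. open V \<and> 0 \<in> V \<and> V \<subseteq> C \<and> C \<subseteq> (\<lambda>x. b - x) -` (- W) \<and>
      (\<forall>x\<in>C. \<forall>y\<in>C. \<forall>u\<ge>0. \<forall>v\<ge>0. u + v = 1 \<longrightarrow> u *\<^sub>R x + v *\<^sub>R y \<in> C)"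
    by (rule locally_convex_zero)
  then obtain V C where V: "open V" "0 \<in> V" "V \<subseteq> C" and C: "C \<subseteq> (\<lambda>x. b - x) -` (- W)"
    and conv: "\<forall>x\<in>C. \<forall>y\<in>C. \<forall>u\<ge>0. \<forall>v\<ge>0. u + v = 1 \<longrightarrow> u *\<^sub>R x + v *\<^sub>R y \<in> C"
    by (elim exE conjE)
  have "convex C" using conv unfolding convex_def by blast
  define K where "K = {x + y | x y. x \<in> C \<and> y \<in> W}"
  define p where "p = gauge_functional K"
  have CK: "C \<subseteq> K" and WK: "W \<subseteq> K"
  proof -
    have "x + 0 \<in> K" if "x \<in> C" for x using that subspace_0[OF W(1)] unfolding K_def by blast
    then show "C \<subseteq> K" by auto
    have "0 + y \<in> K" if "y \<in> W" for y using that V unfolding K_def by blast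
    then show "W \<subseteq> K" by auto
  qed
  have "convex K"
    using convex_sums[OF \<open>convex C\<close> subspace_imp_convex[OF W(1)]] unfolding K_def
    by (rule back_subst[of convex]) auto
  have "0 \<in> K" using V CK by blast
  have absorbing: "\<exists>t>0. x /\<^sub>R t \<in> K" for x
  proof -
    have "((\<lambda>s. s *\<^sub>R x) \<longlongrightarrow> 0 *\<^sub>R x) (at_right (0::real))"
      by (intro tendsto_scaleR_topological tendsto_intros)
    then have "\<forall>\<^sub>F s in at_right (0::real). s *\<^sub>R x \<in> V"
      using V by (auto dest!: topological_tendstoD)
    then have "\<forall>\<^sub>F s in at_right (0::real). s *\<^sub>R x \<in> V \<and> 0 < s"
      using eventually_at_right_less by (rule eventually_conj)
    then obtain s :: real where "s *\<^sub>R x \<in> V" "0 < s"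
      using eventually_happens'[OF trivial_limit_at_right_real] by blast
    then show ?thesis using V CK by (intro exI[of _ "inverse s"]) auto
  qed
  have "b \<notin> K"
  proof
    assume "b \<in> K"
    then obtain x y where "b = x + y" "x \<in> C" "y \<in> W" unfolding K_def by blast
    then show False using C by auto
  qed
  have p: "sublinear p"
    unfolding p_def using \<open>convex K\<close> \<open>0 \<in> K\<close> absorbing by (rule sublinear_gauge_functional)
  obtain f where f: "linear f" "\<And>x. f x \<le> p x" "f b = p b"
    using linear_below_sublinear_attaining[OF p] by metis
  have "1 \<le> f b"
    unfolding f(3) p_def by (rule gauge_functional_ge_1[OF \<open>convex K\<close> \<open>0 \<in> K\<close> absorbing \<open>b \<notin> K\<close>])
  have f_le_0: "f w \<le> 0" if "w \<in> W" for w
  proof (rule field_le_epsilon)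
    fix t :: real assume "0 < t"
    have "w /\<^sub>R t \<in> K" using WK W(1) that by (auto intro: subspace_scale)
    then have "p w \<le> t" unfolding p_def using \<open>0 < t\<close> by (intro gauge_functional_le)
    then show "f w \<le> 0 + t" using f(2)[of w] by simp
  qed
  have vanish: "f w = 0" if "w \<in> W" for w
    using f_le_0[OF that] f_le_0[of "- w"] that W(1) f(1) by (simp add: subspace_neg linear_neg)
  have "f x \<le> 1" if "x \<in> V" for x
  proof -
    have "p x \<le> 1" unfolding p_def using that V CK by (intro gauge_functional_le) auto
    then show ?thesis using f(2)[of x] by simp
  qed
  then have "continuous_linear f"
    using continuous_linear_if_bounded_above_near_0[OF f(1) V(1,2) _ zero_less_one] by blast
  then have "(\<lambda>x. f x / f b) \<in> topological_dual"
    using \<open>1 \<le> f b\<close> unfolding topological_dual_def continuous_linear_def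
    by (auto intro!: linearI continuous_intros simp: linear_add linear_scale add_divide_distrib)
  then show ?thesis using that vanish \<open>1 \<le> f b\<close> by fastforce
qed

lemma topological_dualD:
  assumes "f \<in> topological_dual"
  shows "linear f" "continuous_on UNIV f"
  using assms by (simp_all add: topological_dual_def continuous_linear_def)

lemma topological_dual_sum:
  assumes "\<And>i. i \<in> I \<Longrightarrow> f i \<in> topological_dual"
  shows "(\<lambda>x. \<Sum>i\<in>I. c i * f i x) \<in> topological_dual"
proof -
  have "linear (\<lambda>x. \<Sum>i\<in>I. c i * f i x)"
  proof (rule linearI)
    fix x y and r :: real
    show "(\<Sum>i\<in>I. c i * f i (x + y)) = (\<Sum>i\<in>I. c i * f i x) + (\<Sum>i\<in>I. c i * f i y)"
      unfolding sum.distrib[symmetric]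
      by (intro sum.cong refl) (simp add: linear_add[OF topological_dualD(1)[OF assms]] distrib_left)
    show "(\<Sum>i\<in>I. c i * f i (r *\<^sub>R x)) = r *\<^sub>R (\<Sum>i\<in>I. c i * f i x)"
      unfolding scaleR_sum_right
      by (intro sum.cong refl) (simp add: linear_scale[OF topological_dualD(1)[OF assms]])
  qed
  then show ?thesis
    using topological_dualD(2)[OF assms]
    by (auto simp: topological_dual_def continuous_linear_def intro!: continuous_intros)
qed

lemma closed_kernel:
  assumes "f \<in> topological_dual"
  shows "closed {x. f x = 0}"
  using topological_dualD(2)[OF assms] by (intro closed_Collect_eq continuous_on_const)

lemma subspace_kernel_functional: "linear f \<Longrightarrow> subspace {x. f x = (0::real)}"
  by (auto simp: subspace_def linear_0 linear_add linear_scale)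

section \<open>Images of subspaces of finite codimension\<close>

lemma coset_of_eqI:
  assumes "subspace X0" "x - y \<in> X0"
  shows "coset_of X0 x = coset_of X0 y"
proof -
  have "\<exists>v\<in>X0. x + u = y + v" if "u \<in> X0" for u
    using subspace_add[OF assms that] by (intro bexI[of _ "x - y + u"]) auto
  moreover have "\<exists>v\<in>X0. y + u = x + v" if "u \<in> X0" for u
    using subspace_diff[OF assms(1) that assms(2)] by (intro bexI[of _ "u - (x - y)"]) auto
  ultimately show ?thesis unfolding coset_of_def by blast
qed

lemma finite_codimensional_UNIV: "finite_codimensional (UNIV :: 'a::real_vector set)"
proof -
  have "coset_of UNIV x = coset_of UNIV 0" for x :: 'a
    by (rule coset_of_eqI) simp_all
  then have ex: "\<exists>c. coset_of UNIV x = coset_of UNIV (\<Sum>b\<in>{}. c b *\<^sub>R b)" for x :: 'a by simp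
  show ?thesis
    unfolding finite_codimensional_def
    by (intro conjI exI[of _ "{}"] allI finite.intros subspace_UNIV ex)
qed

lemma finite_codimensional_kernel:
  fixes f :: "'a::real_vector \<Rightarrow> real"
  assumes "linear f"
  shows "finite_codimensional {x. f x = 0}"
proof -
  have sub: "subspace {x. f x = 0}" by (rule subspace_kernel_functional[OF assms])
  show ?thesis
  proof (cases "\<forall>x. f x = 0")
    case True
    then show ?thesis using finite_codimensional_UNIV by simp
  next
    case False
    then obtain b where b: "f b \<noteq> 0" by blast
    have "coset_of {x. f x = 0} x = coset_of {x. f x = 0} (\<Sum>b'\<in>{b}. (f x / f b) *\<^sub>R b')" for x
      using b assms by (intro coset_of_eqI[OF sub]) (simp add: linear_diff linear_scale)
    then have ex: "\<exists>c. coset_of {x. f x = 0} x = coset_of {x. f x = 0} (\<Sum>b\<in>{b}. c b *\<^sub>R b)" for x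
      by (intro exI[of _ "\<lambda>_. f x / f b"]) simp
    then show ?thesis
      unfolding finite_codimensional_def
      by (intro conjI exI[of _ "{b}"] allI finite.intros sub ex)
  qed
qed

text \<open>
  The functional \<open>A x \<mapsto> g x\<close> is well defined on \<open>range A\<close>, but without further information it
  need not be continuous. Here its kernel \<open>A ` ker g\<close> is closed in the whole target space. A
  continuous functional that vanishes on this kernel and has the value \<open>1\<close> at a point \<open>A x1\<close> with
  \<open>g x1 = 1\<close> agrees with it on \<open>range A\<close>, because \<open>x - g x *\<^sub>R x1\<close> lies in \<open>ker g\<close>.
\<close>

lemma factor_through_continuous_functional:
  fixes A :: "'a::locally_convex_hausdorff_space \<Rightarrow> 'b::locally_convex_hausdorff_space"
  assumes A: "linear A" "closed_under_finite_codimensional_subspaces A"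
    and g: "g \<in> topological_dual" and vanish: "\<And>x. A x = 0 \<Longrightarrow> g x = 0"
  obtains \<psi> where "\<psi> \<in> topological_dual" "\<And>x. \<psi> (A x) = g x"
proof (cases "\<forall>x. g x = 0")
  case True
  have "(\<lambda>_ :: 'b. 0) \<in> topological_dual"
    by (auto simp: topological_dual_def continuous_linear_def intro: linearI)
  then show ?thesis by (rule that) (simp add: True)
next
  case False
  then obtain x0 where x0: "g x0 \<noteq> 0" by blast
  have lin: "linear g" by (rule topological_dualD(1)[OF g])
  define x1 where "x1 = x0 /\<^sub>R g x0"
  have x1: "g x1 = 1" using x0 lin by (simp add: x1_def linear_scale)
  define W where "W = A ` {x. g x = 0}"
  have "subspace W"
    unfolding W_def by (intro linear_subspace_image[OF A(1)] subspace_kernel_functional[OF lin])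
  have "closed W"
    using A(2) closed_kernel[OF g] subspace_kernel_functional[OF lin] finite_codimensional_kernel[OF lin]
    unfolding W_def closed_under_finite_codimensional_subspaces_def by blast
  have "A x1 \<notin> W"
  proof
    assume "A x1 \<in> W"
    then obtain x where "g x = 0" "A x1 = A x" unfolding W_def by blast
    then have "g (x1 - x) = 0" using A(1) by (intro vanish) (simp add: linear_diff)
    then show False using x1 \<open>g x = 0\<close> lin by (simp add: linear_diff)
  qed
  then obtain \<psi> where \<psi>: "\<psi> \<in> topological_dual" "\<And>w. w \<in> W \<Longrightarrow> \<psi> w = 0" "\<psi> (A x1) = 1"
    using hahn_banach_separation_from_subspace[OF \<open>subspace W\<close> \<open>closed W\<close>] by metis
  have "\<psi> (A x) = g x" for x
  proof -
    have "g (x - g x *\<^sub>R x1) = 0" using x1 lin by (simp add: linear_diff linear_scale)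
    then have "\<psi> (A (x - g x *\<^sub>R x1)) = 0" using \<psi>(2) unfolding W_def by blast
    then show ?thesis
      using A(1) topological_dualD(1)[OF \<psi>(1)] \<psi>(3) by (simp add: linear_diff linear_scale)
  qed
  then show ?thesis using that \<psi>(1) by blast
qed

section \<open>Ranges of generalized polyhedral multifunctions\<close>

lemma generalized_polyhedral_convexI:
  assumes "finite I" "affine L" "closed L" "\<And>i. i \<in> I \<Longrightarrow> f i \<in> topological_dual"
    and D: "\<And>x. x \<in> D \<longleftrightarrow> x \<in> L \<and> (\<forall>i\<in>I. f i x \<le> \<alpha> i)"
  shows "generalized_polyhedral_convex D"
proof -
  obtain h where h: "bij_betw h {1..card I} I"
    using ex_bij_betw_nat_finite_1[OF assms(1)] by blast
  have I: "I = h ` {1..card I}" using h by (simp add: bij_betw_def)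
  have "D = {x. x \<in> L \<and> (\<forall>n\<in>{1..card I}. (f \<circ> h) n x \<le> (\<alpha> \<circ> h) n)}"
    using D by (subst (asm) I) auto
  moreover have "\<forall>n\<in>{1..card I}. (f \<circ> h) n \<in> topological_dual"
    using assms(4) bij_betwE[OF h] by simp
  ultimately show ?thesis
    unfolding generalized_polyhedral_convex_def using assms(2,3) by blast
qed

theorem theorem3p2:
  fixes F :: "'x::locally_convex_hausdorff_space \<Rightarrow> 'y::locally_convex_hausdorff_space set"
    and A1 :: "'x \<Rightarrow> 'z::locally_convex_hausdorff_space"
    and A2 :: "'y \<Rightarrow> 'z"
    and z :: 'z
    and m :: nat
    and xs :: "nat \<Rightarrow> 'x \<Rightarrow> real"
    and ys :: "nat \<Rightarrow> 'y \<Rightarrow> real"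
    and \<beta> :: "nat \<Rightarrow> real"
  assumes "continuous_linear A1"
    and "continuous_linear A2"
    and "\<And>i. i \<in> {1..m} \<Longrightarrow> xs i \<in> topological_dual"
    and "\<And>i. i \<in> {1..m} \<Longrightarrow> ys i \<in> topological_dual"
    and "gph F = {(x, y). A1 x + A2 y = z \<and> (\<forall>i\<in>{1..m}. xs i x + ys i y \<le> \<beta> i)}"
    and "closed_under_finite_codimensional_subspaces A1"
  shows "generalized_polyhedral_convex (rge F)"
proof -
  have A1: "linear A1" and A2: "linear A2" "continuous_on UNIV A2"
    using assms(1,2) by (simp_all add: continuous_linear_def)
  define K where "K = {x. A1 x = 0}"
  have "subspace K" using A1 by (auto simp: K_def subspace_def linear_0 linear_add linear_scale)
  have xs_linear: "linear (xs i)" if "i \<in> {1..m}" for i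
    using topological_dualD(1) assms(3) that by blast
  obtain \<Lambda> where \<Lambda>: "finite \<Lambda>" and
    feas: "\<And>u. (\<exists>k\<in>K. \<forall>i\<in>{1..m}. xs i k \<le> u i) \<longleftrightarrow> (\<forall>c\<in>\<Lambda>. 0 \<le> (\<Sum>i\<in>{1..m}. c i * u i))"
    using feasible_rhs_polyhedral[of "{1..m}" xs K] xs_linear \<open>subspace K\<close> by auto
  define g where "g c x = (\<Sum>i\<in>{1..m}. c i * xs i x)" for c x
  have g_dual: "g c \<in> topological_dual" for c
    unfolding g_def using assms(3) by (rule topological_dual_sum)
  have g_nonneg: "0 \<le> g c k" if "k \<in> K" "c \<in> \<Lambda>" for c k
    using feas[of "\<lambda>i. xs i k"] that unfolding g_def by blast
  have "g c k = 0" if "A1 k = 0" "c \<in> \<Lambda>" for c k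
  proof -
    have "k \<in> K" "- k \<in> K" using that A1 by (simp_all add: K_def linear_neg)
    then show ?thesis
      using g_nonneg[of k c] g_nonneg[of "- k" c] topological_dualD(1)[OF g_dual] that(2)
      by (simp add: linear_neg)
  qed
  then have "\<forall>c\<in>\<Lambda>. \<exists>\<psi>. \<psi> \<in> topological_dual \<and> (\<forall>x. \<psi> (A1 x) = g c x)"
    using factor_through_continuous_functional[OF A1 assms(6) g_dual] by metis
  then obtain \<psi> where \<psi>: "\<And>c. c \<in> \<Lambda> \<Longrightarrow> \<psi> c \<in> topological_dual"
    "\<And>c x. c \<in> \<Lambda> \<Longrightarrow> \<psi> c (A1 x) = g c x" by metis
  define L where "L = {y. z - A2 y \<in> range A1}"
  define f where "f c y = (\<Sum>i\<in>{1..m}. c i * ys i y) - \<psi> c (A2 y)" for c y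
  define \<alpha> where "\<alpha> c = (\<Sum>i\<in>{1..m}. c i * \<beta> i) - \<psi> c z" for c
  show ?thesis
  proof (rule generalized_polyhedral_convexI[OF \<Lambda>])
    show "affine L"
      unfolding affine_def
    proof (intro ballI allI impI)
      fix x y and u v :: real assume "x \<in> L" "y \<in> L" and uv: "u + v = 1"
      then obtain x' y' where "z - A2 x = A1 x'" "z - A2 y = A1 y'" by (auto simp: L_def)
      then have "A1 (u *\<^sub>R x' + v *\<^sub>R y') = u *\<^sub>R (z - A2 x) + v *\<^sub>R (z - A2 y)"
        using A1 by (simp add: linear_add linear_scale)
      also have "\<dots> = (u + v) *\<^sub>R z - A2 (u *\<^sub>R x + v *\<^sub>R y)"
        using A2(1) by (simp add: linear_add linear_scale algebra_simps)
      finally show "u *\<^sub>R x + v *\<^sub>R y \<in> L" unfolding L_def uv by (metis mem_Collect_eq rangeI scaleR_one)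
    qed
    have "closed (range A1)"
      using assms(6) finite_codimensional_UNIV[where 'a = 'x]
      unfolding closed_under_finite_codimensional_subspaces_def by simp
    then have "closed ((\<lambda>y. z - A2 y) -` range A1)"
      using A2(2) by (intro closed_vimage continuous_on_diff continuous_on_const)
    then show "closed L" by (simp add: L_def vimage_def)
    show "f c \<in> topological_dual" if "c \<in> \<Lambda>" for c
    proof -
      have S: "(\<lambda>y. \<Sum>i\<in>{1..m}. c i * ys i y) \<in> topological_dual"
        using assms(4) by (rule topological_dual_sum)
      note \<psi>c = topological_dualD[OF \<psi>(1)[OF that]]
      have "linear (\<lambda>y. \<psi> c (A2 y))" using linear_compose[OF A2(1) \<psi>c(1)] by (simp add: comp_def)
      moreover have "continuous_on UNIV (\<lambda>y. \<psi> c (A2 y))"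
        using continuous_on_compose2[OF \<psi>c(2) A2(2)] by simp
      ultimately show ?thesis
        unfolding f_def topological_dual_def continuous_linear_def
        using topological_dualD[OF S] by (auto intro: linear_compose_sub continuous_on_diff)
    qed
    show "y \<in> rge F \<longleftrightarrow> y \<in> L \<and> (\<forall>c\<in>\<Lambda>. f c y \<le> \<alpha> c)" for y
    proof -
      have "y \<in> rge F \<longleftrightarrow> (\<exists>x. (x, y) \<in> gph F)" by (simp add: rge_def gph_def)
      then have rge: "y \<in> rge F \<longleftrightarrow> (\<exists>x. A1 x = z - A2 y \<and> (\<forall>i\<in>{1..m}. xs i x \<le> \<beta> i - ys i y))"
        unfolding assms(5) by (simp add: algebra_simps)
      show ?thesis
      proof (cases "y \<in> L")
        case False
        have "\<not> (\<exists>x. A1 x = z - A2 y)" using False unfolding L_def by (metis mem_Collect_eq rangeI)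
        then show ?thesis using False rge by blast
      next
        case True
        then obtain x0 where x0: "A1 x0 = z - A2 y" by (auto simp: L_def)
        have solutions: "A1 x = z - A2 y \<longleftrightarrow> (\<exists>k\<in>K. x = x0 + k)" for x
        proof
          assume "A1 x = z - A2 y"
          then have "x - x0 \<in> K" using x0 A1 by (simp add: K_def linear_diff)
          then show "\<exists>k\<in>K. x = x0 + k" by (intro bexI[of _ "x - x0"]) auto
        next
          assume "\<exists>k\<in>K. x = x0 + k"
          then show "A1 x = z - A2 y" using x0 A1 by (auto simp: K_def linear_add)
        qed
        have "y \<in> rge F \<longleftrightarrow> (\<exists>k\<in>K. \<forall>i\<in>{1..m}. xs i (x0 + k) \<le> \<beta> i - ys i y)"
          unfolding rge solutions by blast
        also have "\<dots> \<longleftrightarrow> (\<exists>k\<in>K. \<forall>i\<in>{1..m}. xs i k \<le> \<beta> i - ys i y - xs i x0)"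
          using xs_linear by (intro bex_cong ball_cong refl) (simp add: linear_add algebra_simps)
        also have "\<dots> \<longleftrightarrow> (\<forall>c\<in>\<Lambda>. 0 \<le> (\<Sum>i\<in>{1..m}. c i * (\<beta> i - ys i y - xs i x0)))"
          by (rule feas)
        also have "\<dots> \<longleftrightarrow> (\<forall>c\<in>\<Lambda>. f c y \<le> \<alpha> c)"
        proof (intro ball_cong refl)
          fix c assume c: "c \<in> \<Lambda>"
          have "\<psi> c z - \<psi> c (A2 y) = g c x0"
            using \<psi>(2)[OF c, of x0] x0 topological_dualD(1)[OF \<psi>(1)[OF c]] by (simp add: linear_diff)
          then have "\<alpha> c - f c y = (\<Sum>i\<in>{1..m}. c i * (\<beta> i - ys i y - xs i x0))"
            by (simp add: \<alpha>_def f_def g_def right_diff_distrib sum_subtractf)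
          then show "0 \<le> (\<Sum>i\<in>{1..m}. c i * (\<beta> i - ys i y - xs i x0)) \<longleftrightarrow> f c y \<le> \<alpha> c" by linarith
        qed
        finally show ?thesis using True by simp
      qed
    qed
  qed
qed

end
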